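(* Let $d, N\in \mathbb{N}$ and $\rho \in [0,\infty)$. Let $\mathcal{P}= (p_j)_{j=1}^N$ be a $\mathcal{C}^d_0$-$e^{\rho d}$-negatively dependent sampling scheme in $[0,1)^d$. Then for every $c > 0$ the inequality $$D^*_N(\mathcal{P}) \leq c\sqrt{\frac{d}{N} \max \left\{ 1, \log\left( \frac{N}{d} \right) \right\}}$$ holds with probability at least $$1 - 2 \exp\left(\left(-\tfrac{1}{2}(c^2 - 1)\xi + \rho + \log\left(2e\left(\tfrac{2}{c} +1\right)\right)\right)d\right),$$ where $\xi = \max\left\{1, \log\left( \frac{N}{d} \right) \right\}$. Moreover, for every $\theta \in (0,1)$ $$\mathbf{P}\left(D^{*}_N(\mathcal{P}) \leq \sqrt{\frac{2}{N}} \sqrt{d \log(\eta) + \rho d + \log\left( \frac{2}{1 - \theta} \right)} \right) \geq \theta,$$ where $\eta= \eta(N,d) = 6e \left( \max\left(1, \frac{N}{2d \log(6e)}\right) \right)^{1/2}$.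
   Context: All random variables are defined on a probability space $(\Omega,\Sigma,\mathbf{P})$; $\log$ is the natural logarithm; $[N]=\{1,\ldots,N\}$; $\lambda^d$ is $d$-dimensional Lebesgue measure; $\mathbf{1}_A$ is the indicator function of $A$. For $a\in[0,1]^d$, $[0,a)=[0,a_1)\times\cdots\times[0,a_d)$, and $\mathcal{C}^d_0 = \{[0,a) \mid a \in [0,1)^d\}$. Sampling scheme: a random family $\mathcal{P}=(p_j)_{j=1}^N$ of points in $[0,1)^d$ such that each $p_j$ is uniformly distributed in $[0,1)^d$ and $(p_1,\ldots,p_N)$ is exchangeable, i.e. for every permutation $\pi$ of $[N]$ the law of $(p_{\pi(1)},\ldots,p_{\pi(N)})$ equals the law of $(p_1,\ldots,p_N)$. Negative dependence: for $\gamma\ge 1$, random variables $T_1,\ldots,T_N$ with values in $\{0,1\}$ are $\gamma$-negatively dependent if for all $u\subseteq[N]$ both $\mathbf{P}(\bigcap_{j\in u}\{T_j=1\})\le\gamma\prod_{j\in u}\mathbf{P}(T_j=1)$ and $\mathbf{P}(\bigcap_{j\in u}\{T_j=0\})\le\gamma\prod_{j\in u}\mathbf{P}(T_j=0)$. For a system $\mathcal{S}$ of measurable subsets of $[0,1)^d$, a sampling scheme $(p_j)_{j=1}^N$ is $\mathcal{S}$-$\gamma$-negatively dependent if for every $Q\in\mathcal{S}$ the random variables $\mathbf{1}_Q(p_1),\ldots,\mathbf{1}_Q(p_N)$ are $\gamma$-negatively dependent. Star discrepancy: for an $N$-point family $P=(p_j)_{j=1}^N$ in $[0,1)^d$, $$D_N^*(P)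 = \sup_{x\in[0,1]^d}\left|\frac1N\sum_{j=1}^N\mathbf{1}_{[0,x)}(p_j)-\lambda^d([0,x))\right|.$$ *)

theory Defs
  imports "HOL-Probability.Probability" "HOL-Combinatorics.Combinatorics"
begin

text \<open>The dimension is \<open>d = CARD('d)\<close>. On \<^typ>\<open>real ^ 'd\<close> the library order \<open>x < a\<close> is not the
  strict inequality in every coordinate, so half-open boxes are written out coordinatewise.\<close>

definition anchored_box :: "real ^ 'd \<Rightarrow> (real ^ 'd) set" where
  "anchored_box a = {x. \<forall>i. 0 \<le> x $ i \<and> x $ i < a $ i}"

definition half_open_cube :: "(real ^ 'd) set" where
  "half_open_cube = {x. \<forall>i. 0 \<le> x $ i \<and> x $ i < 1}"

definition closed_cube :: "(real ^ 'd) set" where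
  "closed_cube = {x. \<forall>i. 0 \<le> x $ i \<and> x $ i \<le> 1}"

definition anchored_boxes :: "(real ^ 'd) set set" where
  "anchored_boxes = {anchored_box a | a. a \<in> half_open_cube}"

definition exchangeable :: "'w measure \<Rightarrow> nat \<Rightarrow> (nat \<Rightarrow> 'w \<Rightarrow> (real ^ 'd)) \<Rightarrow> bool" where
  "exchangeable M N p \<longleftrightarrow>
     (\<forall>\<pi>. \<pi> permutes {1..N} \<longrightarrow>
        distr M (Pi\<^sub>M {1..N} (\<lambda>_. borel)) (\<lambda>\<omega>. \<lambda>j\<in>{1..N}. p (\<pi> j) \<omega>) =
        distr M (Pi\<^sub>M {1..N} (\<lambda>_. borel)) (\<lambda>\<omega>. \<lambda>j\<in>{1..N}. p j \<omega>))"

text \<open>Only the members \<open>p 1, \<dots>, p N\<close> of the family \<open>p\<close> matter.\<close>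

definition sampling_scheme ::
    "'w measure \<Rightarrow> nat \<Rightarrow> (nat \<Rightarrow> 'w \<Rightarrow> (real ^ 'd)) \<Rightarrow> bool" where
  "sampling_scheme M N p \<longleftrightarrow>
     (\<forall>j\<in>{1..N}. p j \<in> borel_measurable M \<and>
        (\<forall>\<omega>\<in>space M. p j \<omega> \<in> half_open_cube) \<and>
        distr M borel (p j) = uniform_measure lborel half_open_cube) \<and>
     exchangeable M N p"

definition negatively_dependent ::
    "'w measure \<Rightarrow> nat \<Rightarrow> real \<Rightarrow> (nat \<Rightarrow> 'w \<Rightarrow> real) \<Rightarrow> bool" where
  "negatively_dependent M N \<gamma> T \<longleftrightarrow>
     \<gamma> \<ge> 1 \<and>
     (\<forall>j\<in>{1..N}. T j \<in> borel_measurable M \<and> (\<forall>\<omega>\<in>space M. T j \<omega> \<in> {0, 1})) \<and>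
     (\<forall>u\<subseteq>{1..N}.
        measure M {\<omega>\<in>space M. \<forall>j\<in>u. T j \<omega> = 1}
          \<le> \<gamma> * (\<Prod>j\<in>u. measure M {\<omega>\<in>space M. T j \<omega> = 1}) \<and>
        measure M {\<omega>\<in>space M. \<forall>j\<in>u. T j \<omega> = 0}
          \<le> \<gamma> * (\<Prod>j\<in>u. measure M {\<omega>\<in>space M. T j \<omega> = 0}))"

definition neg_dependent_scheme ::
    "'w measure \<Rightarrow> nat \<Rightarrow> (real ^ 'd) set set \<Rightarrow> real \<Rightarrow> (nat \<Rightarrow> 'w \<Rightarrow> (real ^ 'd)) \<Rightarrow> bool" where
  "neg_dependent_scheme M N S \<gamma> p \<longleftrightarrow>
     sampling_scheme M N p \<and>
     (\<forall>Q\<in>S. negatively_dependent M N \<gamma> (\<lambda>j \<omega>. indicator Q (p j \<omega>)))"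

definition star_discrepancy :: "nat \<Rightarrow> (nat \<Rightarrow> real ^ 'd) \<Rightarrow> real" where
  "star_discrepancy N P =
     (SUP x\<in>closed_cube.
        \<bar>1 / real N * (\<Sum>j=1..N. indicator (anchored_box x) (P j)) - measure lborel (anchored_box x)\<bar>)"

definition xi :: "nat \<Rightarrow> nat \<Rightarrow> real" where
  "xi N d = max 1 (ln (real N / real d))"

definition eta :: "nat \<Rightarrow> nat \<Rightarrow> real" where
  "eta N d = 6 * exp 1 * (max 1 (real N / (2 * real d * ln (6 * exp 1)))) powr (1/2)"

end

theory Submission
  imports Defs
begin

text \<open>Fix \<open>\<delta> > 0\<close>. The cube has a cover by at most \<open>(e (1/\<delta> + 1))\<^sup>d\<close> order intervals \<open>[a, b]\<close>
  with \<open>\<Prod>b - \<Prod>a \<le> \<delta>\<close>, and if the local discrepancy is at most \<open>\<delta>\<close> in modulus at all end points, then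
  the star discrepancy is at most \<open>2 \<delta>\<close>. At a single point, expanding
  \<open>exp (s T\<^sub>1 + \<dots> + s T\<^sub>N) = \<Prod>(1 + (exp s - 1) T\<^sub>j)\<close> shows that negative dependence costs only the
  factor \<open>\<gamma>\<close> in the exponential moment, so Hoeffding's bound \<open>2 \<gamma> exp (-2 N \<delta>\<^sup>2)\<close> holds. The
  union bound over the end points gives the tail estimate, and the two claims are two choices of
  \<open>\<delta>\<close>.\<close>

section \<open>Cardinality estimate for the bracketing cover\<close>

lemma power_div_fact_le_exp:
  fixes x :: real
  assumes "0 \<le> x"
  shows "x ^ n / fact n \<le> exp x"
proof -
  have "(\<Sum>k\<in>{n}. inverse (fact k) *\<^sub>R x ^ k) \<le> (\<Sum>k. inverse (fact k) *\<^sub>R x ^ k)"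
    using assms by (intro sum_le_suminf summable_exp_generic) auto
  then show ?thesis
    by (simp add: exp_def field_simps)
qed

text \<open>This is the size of the cover from \<open>bracketing_cover\<close> once \<open>m\<close>
  is taken just large enough for precision \<open>\<delta>\<close>. The ceiling adds less than 1,
  which the \<open>- 1\<close> absorbs, so \<open>m + d - 1\<close> is at most
  \<open>d * (1 / \<delta> + 1)\<close>; the leftover factor \<open>d ^ d / fact d\<close> is one
  term of the series of \<open>exp d\<close>.\<close>

lemma binomial_le_exp_power:
  fixes \<delta> :: real
  assumes "0 < \<delta>" "0 < d"
  defines "m \<equiv> nat \<lceil>real d / \<delta>\<rceil>"
  shows "real ((m + d - 1) choose d) \<le> (exp 1 * (1 / \<delta> + 1)) ^ d"
proof -
  have "0 < real d / \<delta>" using assms by simp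
  then have "real m < real d / \<delta> + 1"
    unfolding m_def by linarith
  then have m: "real (m + d - 1) \<le> real d * (1 / \<delta> + 1)"
    using \<open>0 < d\<close> by (simp add: of_nat_diff algebra_simps)
  have "real ((m + d - 1) choose d) * fact d = real (((m + d - 1) choose d) * fact d)"
    by simp
  also have "\<dots> \<le> real ((m + d - 1) ^ d)"
    using binomial_fact_pow by (intro of_nat_mono)
  also have "\<dots> \<le> (real d * (1 / \<delta> + 1)) ^ d"
    using m by (simp add: power_mono)
  also have "\<dots> = real d ^ d * (1 / \<delta> + 1) ^ d"
    by (rule power_mult_distrib)
  finally have "real ((m + d - 1) choose d) \<le> (real d ^ d / fact d) * (1 / \<delta> + 1) ^ d"
    by (simp add: pos_le_divide_eq)
  also have "\<dots> \<le> exp (real d) * (1 / \<delta> + 1) ^ d"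
    using assms by (intro mult_right_mono power_div_fact_le_exp) auto
  also have "exp (real d) = exp 1 ^ d"
    by (simp add: exp_of_nat_mult[symmetric])
  finally show ?thesis
    by (simp add: power_mult_distrib)
qed

section \<open>Bracketing covers of the unit cube\<close>

text \<open>End points are functions inspected only on \<open>I\<close> rather than vectors, so that
  the number of coordinates can vary in the induction that builds the cover.\<close>

definition brackets :: "('i \<Rightarrow> real) \<times> ('i \<Rightarrow> real) \<Rightarrow> 'i set \<Rightarrow> ('i \<Rightarrow> real) \<Rightarrow> bool" where
  "brackets c I x \<longleftrightarrow> (\<forall>i\<in>I. 0 \<le> fst c i \<and> fst c i \<le> x i \<and> x i \<le> snd c i \<and> snd c i \<le> 1)"

text \<open>Induction on the dimension: when the new coordinate lies in \<open>[n/m, (n+1)/m]\<close>, a bracket of the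
  remaining \<open>k\<close> coordinates with precision \<open>k/(n+1)\<close> has its error scaled down to
  \<open>(n+1)/m \<cdot> k/(n+1) = k/m\<close>, and the new coordinate itself adds \<open>1/m\<close>. The cardinalities add up by the
  hockey-stick identity.\<close>

lemma bracketing_cover:
  assumes "finite I" "0 < m"
  shows "\<exists>B. finite B \<and> card B \<le> (m + card I - 1) choose card I \<and>
           (\<forall>x. (\<forall>i\<in>I. 0 \<le> x i \<and> x i \<le> 1) \<longrightarrow>
              (\<exists>c\<in>B. brackets c I x \<and> prod (snd c) I - prod (fst c) I \<le> real (card I) / real m))"
  using assms
proof (induction I arbitrary: m rule: finite_induct)
  case empty
  show ?case
    by (intro exI[of _ "{(\<lambda>_. 0, \<lambda>_. 0)}"]) (auto simp: brackets_def)
next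
  case (insert k I)
  let ?good = "\<lambda>n B. finite B \<and> card B \<le> (n + card I - 1) choose card I \<and>
           (\<forall>x. (\<forall>i\<in>I. 0 \<le> x i \<and> x i \<le> 1) \<longrightarrow>
              (\<exists>c\<in>B. brackets c I x \<and> prod (snd c) I - prod (fst c) I \<le> real (card I) / real n))"
  obtain B where B: "\<And>n. 0 < n \<Longrightarrow> ?good n (B n)"
    using insert.IH by metis
  define ext where "ext n c = ((fst c)(k := real n / real m), (snd c)(k := real (Suc n) / real m))"
    for n and c :: "('a \<Rightarrow> real) \<times> ('a \<Rightarrow> real)"
  define C where "C = (\<Union>n<m. ext n ` B (Suc n))"
  have "finite C"
    unfolding C_def using B by auto
  moreover have "card C \<le> (m + card (insert k I) - 1) choose card (insert k I)"
  proof -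
    have "card C \<le> (\<Sum>n<m. card (ext n ` B (Suc n)))"
      unfolding C_def by (intro card_UN_le) auto
    also have "\<dots> \<le> (\<Sum>n<m. (card I + n) choose card I)"
    proof (rule sum_mono)
      fix n
      have "card (ext n ` B (Suc n)) \<le> card (B (Suc n))"
        using B by (intro card_image_le) auto
      also have "\<dots> \<le> (card I + n) choose card I"
        using B[of "Suc n"] by (simp add: add.commute)
      finally show "card (ext n ` B (Suc n)) \<le> (card I + n) choose card I" .
    qed
    also have "\<dots> = (\<Sum>n\<le>m - 1. (card I + n) choose card I)"
      using \<open>0 < m\<close> by (intro sum.cong) auto
    also have "\<dots> = (m + card (insert k I) - 1) choose card (insert k I)"
      unfolding choose_rising_sum(1) using insert.hyps \<open>0 < m\<close> by (simp add: add.commute)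
    finally show ?thesis .
  qed
  moreover have "\<exists>c\<in>C. brackets c (insert k I) x \<and>
      prod (snd c) (insert k I) - prod (fst c) (insert k I) \<le> real (card (insert k I)) / real m"
    if x: "\<forall>i\<in>insert k I. 0 \<le> x i \<and> x i \<le> 1" for x
  proof -
    \<comment> \<open>Rounding up and subtracting 1 puts \<open>x k = 1\<close> into the last slab
      \<open>m - 1\<close>, where rounding down would give \<open>m\<close>. At
      \<open>x k = 0\<close> the value -1 is truncated to 0 by \<open>nat\<close>.\<close>
    define n where "n = nat (\<lceil>real m * x k\<rceil> - 1)"
    have xk: "0 \<le> x k" "x k \<le> 1" using x by auto
    have mx: "0 \<le> real m * x k" "real m * x k \<le> real m"
      using xk by (auto simp: mult_left_le)
    have n: "n < m" "real n \<le> real m * x k" "real m * x k \<le> real (Suc n)"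
      unfolding n_def using mx \<open>0 < m\<close> by (linarith)+
    obtain c where c: "c \<in> B (Suc n)" "brackets c I x"
        "prod (snd c) I - prod (fst c) I \<le> real (card I) / real (Suc n)"
      using B[of "Suc n"] x by blast
    have neq: "i \<noteq> k" if "i \<in> I" for i using that insert.hyps by auto
    have prods: "prod (snd (ext n c)) (insert k I) = real (Suc n) / real m * prod (snd c) I"
        "prod (fst (ext n c)) (insert k I) = real n / real m * prod (fst c) I"
      using insert.hyps neq unfolding ext_def
      by (auto intro!: arg_cong2[where f = "(*)"] prod.cong)
    have "prod (fst c) I \<le> 1"
      using c(2) by (intro prod_le_1) (force simp: brackets_def)
    \<comment> \<open>With \<open>a\<close> and \<open>b\<close> the lower and upper products over
      \<open>I\<close>, this is \<open>(n + 1) * b - n * a = (n + 1) * (b - a) + a\<close>, divided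
      by \<open>m\<close>. The last term costs at most \<open>1 / m\<close> since
      \<open>a \<le> 1\<close>.\<close>
    have "prod (snd (ext n c)) (insert k I) - prod (fst (ext n c)) (insert k I) =
        real (Suc n) / real m * (prod (snd c) I - prod (fst c) I) + 1 / real m * prod (fst c) I"
      unfolding prods using \<open>0 < m\<close> by (simp add: field_simps)
    also have "\<dots> \<le> real (Suc n) / real m * (real (card I) / real (Suc n)) + 1 / real m * 1"
      using c(3) \<open>prod (fst c) I \<le> 1\<close> by (intro add_mono mult_left_mono) auto
    also have "\<dots> = (real (card I) + 1) / real m"
      by (simp add: add_divide_distrib del: of_nat_Suc)
    also have "\<dots> = real (card (insert k I)) / real m"
      using insert.hyps by simp
    finally have "prod (snd (ext n c)) (insert k I) - prod (fst (ext n c)) (insert k I)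
        \<le> real (card (insert k I)) / real m" .
    moreover have "brackets (ext n c) (insert k I) x"
      using c(2) n \<open>0 < m\<close> neq
      by (auto simp: brackets_def ext_def pos_divide_le_eq pos_le_divide_eq mult.commute)
    moreover have "ext n c \<in> C"
      unfolding C_def using c(1) n(1) by auto
    ultimately show ?thesis by blast
  qed
  ultimately show ?case by blast
qed

section \<open>Anchored boxes and their volumes\<close>

lemma anchored_box_borel [measurable]:
  fixes a :: "real ^ 'd"
  shows "anchored_box a \<in> sets borel"
proof -
  have "anchored_box a = (\<Inter>i. {x. 0 \<le> x $ i} \<inter> {x. x $ i < a $ i})"
    by (auto simp: anchored_box_def)
  moreover have "{x::real^'d. 0 \<le> x $ i} \<inter> {x. x $ i < a $ i} \<in> sets borel" for i
    using closed_halfspace_component_ge_cart[of 0 i] open_halfspace_component_lt_cart[of i "a $ i"]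
    by (intro sets.Int borel_closed borel_open) auto
  ultimately show ?thesis by auto
qed

lemma anchored_box_mono:
  assumes "\<And>i. x $ i \<le> y $ i"
  shows "anchored_box x \<subseteq> anchored_box y"
  unfolding anchored_box_def using assms by (auto intro: less_le_trans)

lemma closed_cube_downward:
  assumes "x \<in> closed_cube" "\<And>i. 0 \<le> y $ i" "\<And>i. y $ i \<le> x $ i"
  shows "y \<in> closed_cube"
  unfolding closed_cube_def
proof (intro CollectI allI conjI)
  fix i
  show "y $ i \<le> 1"
    using assms(3)[of i] assms(1) order_trans[of "y $ i" "x $ i" 1] by (simp add: closed_cube_def)
qed (rule assms(2))

text \<open>The half-open box lies between \<open>box 0 a\<close> and \<open>cbox 0 a\<close>, which
  have equal volume.\<close>

lemma emeasure_anchored_box: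
  fixes a :: "real ^ 'd"
  assumes "\<And>i. 0 \<le> a $ i"
  shows "emeasure lborel (anchored_box a) = ennreal (\<Prod>i\<in>UNIV. a $ i)"
proof (rule antisym)
  have comp: "0 \<bullet> b \<le> a \<bullet> b" if "b \<in> Basis" for b :: "real^'d"
    using that assms by (auto simp: Basis_vec_def inner_axis)
  have "inj (\<lambda>i::'d. axis i (1::real))"
    by (auto simp: inj_on_def axis_eq_axis)
  then have prod: "(\<Prod>b\<in>Basis. (a - 0) \<bullet> b) = (\<Prod>i\<in>UNIV. a $ i)"
    by (simp add: Basis_vec_def image_Union[symmetric] UNION_singleton_eq_range
        prod.reindex inner_axis)
  have "emeasure lborel (anchored_box a) \<le> emeasure lborel (cbox 0 a)"
    by (intro emeasure_mono) (auto simp: anchored_box_def mem_box_cart less_imp_le)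
  then show "emeasure lborel (anchored_box a) \<le> ennreal (\<Prod>i\<in>UNIV. a $ i)"
    using emeasure_lborel_cbox[OF comp] prod by simp
  have "emeasure lborel (box 0 a) \<le> emeasure lborel (anchored_box a)"
    by (intro emeasure_mono) (auto simp: anchored_box_def mem_box_cart less_imp_le)
  then show "ennreal (\<Prod>i\<in>UNIV. a $ i) \<le> emeasure lborel (anchored_box a)"
    using emeasure_lborel_box[OF comp] prod by simp
qed

lemma measure_anchored_box:
  fixes a :: "real ^ 'd"
  assumes "a \<in> closed_cube"
  shows "measure lborel (anchored_box a) = (\<Prod>i\<in>UNIV. a $ i)"
  using assms emeasure_anchored_box[of a]
  by (simp add: measure_def closed_cube_def prod_nonneg)

text \<open>The half-open cube is itself the anchored box at the all-ones vector and has volume 1,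
  so normalising by it changes nothing. This yields the probability that a single sample point falls
  into a box.\<close>

lemma measure_uniform_anchored_box:
  fixes a :: "real ^ 'd"
  assumes "a \<in> closed_cube"
  shows "measure (uniform_measure lborel half_open_cube) (anchored_box a) = (\<Prod>i\<in>UNIV. a $ i)"
proof -
  have cube: "half_open_cube = anchored_box (\<chi> i. 1)"
    by (auto simp: half_open_cube_def anchored_box_def)
  have "emeasure lborel (half_open_cube :: (real^'d) set) = 1"
    unfolding cube by (subst emeasure_anchored_box) auto
  then have one: "emeasure lborel (anchored_box (\<chi> i. 1) :: (real^'d) set) = 1"
    unfolding cube .
  moreover have "half_open_cube \<inter> anchored_box a = anchored_box a"
    unfolding cube using assms by (intro Int_absorb1 anchored_box_mono) (simp add: closed_cube_def)
  ultimately have "emeasure (uniform_measure lborel half_open_cube) (anchored_box a) =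
      emeasure lborel (anchored_box a)"
    by (simp add: cube anchored_box_borel divide_ennreal_def)
  then show ?thesis
    using measure_anchored_box[OF assms] by (simp add: measure_def)
qed

section \<open>Local discrepancy, and reduction of the supremum to countably many points\<close>

definition local_discrepancy :: "nat \<Rightarrow> (nat \<Rightarrow> real ^ 'd) \<Rightarrow> real ^ 'd \<Rightarrow> real" where
  "local_discrepancy N P x =
     1 / real N * (\<Sum>j=1..N. indicator (anchored_box x) (P j)) - measure lborel (anchored_box x)"

text \<open>Boxes are open at their upper faces, so a point of the box at \<open>x\<close> satisfies
  finitely many strict inequalities that persist for \<open>y n\<close> with \<open>n\<close> large,
  while a point outside it is outside every smaller box. The indicators are therefore eventually
  constant; this relies on the approach from below.\<close>

lemma local_discrepancy_left_tendsto:
  assumes "x \<in> closed_cube" "\<And>n i. 0 \<le> y n $ i" "\<And>n i. y n $ i \<le> x $ i"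
    and y: "\<And>i. (\<lambda>n. y n $ i) \<longlonglongrightarrow> x $ i"
  shows "(\<lambda>n. local_discrepancy N P (y n)) \<longlonglongrightarrow> local_discrepancy N P x"
proof -
  have y_cube: "y n \<in> closed_cube" for n
    using assms(1-3) by (rule closed_cube_downward)
  have ind: "(\<lambda>n. indicator (anchored_box (y n)) z) \<longlonglongrightarrow> (indicator (anchored_box x) z :: real)" for z
  proof (rule tendsto_eventually, cases "z \<in> anchored_box x")
    case True
    have "eventually (\<lambda>n. \<forall>i\<in>UNIV. z $ i < y n $ i) sequentially"
      using True order_tendstoD(1)[OF y]
      by (intro eventually_ball_finite) (auto simp: anchored_box_def)
    then show "eventually (\<lambda>n. indicator (anchored_box (y n)) z = (indicator (anchored_box x) z :: real)) sequentially"
      by eventually_elim (use True in \<open>auto simp: anchored_box_def indicator_def\<close>)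
  next
    case False
    then have "z \<notin> anchored_box (y n)" for n
      using anchored_box_mono[OF assms(3)] by blast
    with False show "eventually (\<lambda>n. indicator (anchored_box (y n)) z = (indicator (anchored_box x) z :: real)) sequentially"
      by simp
  qed
  show ?thesis
    unfolding local_discrepancy_def measure_anchored_box[OF assms(1)] measure_anchored_box[OF y_cube]
    by (intro tendsto_intros ind y)
qed

text \<open>Both terms lie in \<open>[0, 1]\<close>; for \<open>N = 0\<close> the first is 0 by the
  convention on division. Boundedness is what allows the real supremum to be compared
  pointwise.\<close>

lemma abs_local_discrepancy_le_1:
  assumes "x \<in> closed_cube"
  shows "\<bar>local_discrepancy N P x\<bar> \<le> 1"
proof -
  let ?S = "\<Sum>j=1..N. indicator (anchored_box x) (P j) :: real"
  have "?S \<le> real N"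
    using sum_bounded_above[of "{1..N}" "\<lambda>j. indicator (anchored_box x) (P j)" "1::real"]
    by (simp add: indicator_le_1)
  moreover have "0 \<le> ?S"
    by (intro sum_nonneg) auto
  ultimately have "0 \<le> 1 / real N * ?S" "1 / real N * ?S \<le> 1"
    by (auto simp: divide_le_eq_1)
  moreover have "0 \<le> (\<Prod>i\<in>UNIV. x $ i)" "(\<Prod>i\<in>UNIV. x $ i) \<le> 1"
    using assms by (auto simp: closed_cube_def intro!: prod_nonneg prod_le_1)
  ultimately show ?thesis
    unfolding local_discrepancy_def measure_anchored_box[OF assms] by linarith
qed

lemma star_discrepancy_le_iff:
  fixes P :: "nat \<Rightarrow> real ^ 'd"
  shows "star_discrepancy N P \<le> K \<longleftrightarrow> (\<forall>x\<in>closed_cube. \<bar>local_discrepancy N P x\<bar> \<le> K)"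
proof -
  have "bdd_above ((\<lambda>x. \<bar>local_discrepancy N P x\<bar>) ` closed_cube)"
    using abs_local_discrepancy_le_1 by (intro bdd_aboveI2)
  moreover have "(0 :: real^'d) \<in> closed_cube"
    by (simp add: closed_cube_def)
  ultimately show ?thesis
    unfolding star_discrepancy_def local_discrepancy_def[symmetric]
    by (subst cSUP_le_iff) auto
qed

text \<open>Indexing by functions into \<open>rat\<close> makes the index type countable, as there
  are finitely many coordinates; a quantifier over it preserves measurability.\<close>

definition rat_vec :: "('d \<Rightarrow> rat) \<Rightarrow> real ^ 'd" where
  "rat_vec f = (\<chi> i. of_rat (f i))"

text \<open>Rounding each coordinate of \<open>x\<close> down to a multiple of
  \<open>1 / (n + 1)\<close> gives rational points in the cube that approach \<open>x\<close> from
  below, and the local discrepancy converges along them. The event in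
  \<open>star_discrepancy_le_sets\<close> thereby becomes a countable intersection.\<close>

lemma star_discrepancy_le_iff_rat:
  fixes P :: "nat \<Rightarrow> real ^ 'd"
  shows "star_discrepancy N P \<le> K \<longleftrightarrow>
    (\<forall>f. rat_vec f \<in> closed_cube \<longrightarrow> \<bar>local_discrepancy N P (rat_vec f)\<bar> \<le> K)"
  unfolding star_discrepancy_le_iff
proof (intro iffI ballI allI impI)
  fix x :: "real ^ 'd"
  assume rat: "\<forall>f. rat_vec f \<in> closed_cube \<longrightarrow> \<bar>local_discrepancy N P (rat_vec f)\<bar> \<le> K"
    and x: "x \<in> closed_cube"
  define f where "f n i = of_int \<lfloor>x $ i * real (Suc n)\<rfloor> / rat_of_nat (Suc n)" for n i
  have f_eq: "rat_vec (f n) $ i = of_int \<lfloor>x $ i * real (Suc n)\<rfloor> / real (Suc n)" for n i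
    by (simp add: rat_vec_def f_def of_rat_divide del: of_nat_Suc)
  have nonneg: "0 \<le> rat_vec (f n) $ i" for n i
    using x by (simp add: f_eq closed_cube_def)
  have le: "rat_vec (f n) $ i \<le> x $ i" for n i
    using of_int_floor_le[of "x $ i * real (Suc n)"]
    by (simp add: f_eq pos_divide_le_eq del: of_nat_Suc)
  have ge: "x $ i - 1 / real (Suc n) \<le> rat_vec (f n) $ i" for n i
  proof -
    have "x $ i * real (Suc n) - 1 \<le> of_int \<lfloor>x $ i * real (Suc n)\<rfloor>" by linarith
    then have "(x $ i * real (Suc n) - 1) / real (Suc n) \<le> rat_vec (f n) $ i"
      unfolding f_eq by (intro divide_right_mono) auto
    then show ?thesis
      by (simp add: diff_divide_distrib del: of_nat_Suc)
  qed
  have lim: "(\<lambda>n. rat_vec (f n) $ i) \<longlonglongrightarrow> x $ i" for i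
  proof (rule tendsto_sandwich[where f = "\<lambda>n. x $ i - 1 / real (Suc n)" and h = "\<lambda>_. x $ i"])
    have "(\<lambda>n. x $ i - 1 / real (Suc n)) \<longlonglongrightarrow> x $ i - 0"
      by (intro tendsto_diff tendsto_const LIMSEQ_Suc[OF lim_inverse_n'])
    then show "(\<lambda>n. x $ i - 1 / real (Suc n)) \<longlonglongrightarrow> x $ i"
      by simp
  qed (use ge le in \<open>auto intro!: always_eventually simp del: of_nat_Suc\<close>)
  have "rat_vec (f n) \<in> closed_cube" for n
    using x nonneg le by (rule closed_cube_downward)
  then have "\<bar>local_discrepancy N P (rat_vec (f n))\<bar> \<le> K" for n
    using rat by blast
  moreover have "(\<lambda>n. \<bar>local_discrepancy N P (rat_vec (f n))\<bar>) \<longlonglongrightarrow> \<bar>local_discrepancy N P x\<bar>"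
    by (intro tendsto_rabs local_discrepancy_left_tendsto x nonneg le lim)
  ultimately show "\<bar>local_discrepancy N P x\<bar> \<le> K"
    by (intro LIMSEQ_le_const2) auto
qed auto

lemma local_discrepancy_measurable [measurable]:
  assumes "\<And>j. j \<in> {1..N} \<Longrightarrow> p j \<in> borel_measurable M"
  shows "(\<lambda>\<omega>. local_discrepancy N (\<lambda>j. p j \<omega>) x) \<in> borel_measurable M"
  unfolding local_discrepancy_def
  by (intro borel_measurable_diff borel_measurable_times borel_measurable_sum borel_measurable_const
      measurable_compose[OF assms] borel_measurable_indicator anchored_box_borel)

lemma star_discrepancy_le_sets:
  fixes p :: "nat \<Rightarrow> 'w \<Rightarrow> real ^ 'd"
  assumes "\<And>j. j \<in> {1..N} \<Longrightarrow> p j \<in> borel_measurable M"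
  shows "{\<omega>\<in>space M. star_discrepancy N (\<lambda>j. p j \<omega>) \<le> K} \<in> sets M"
proof -
  note [measurable] = local_discrepancy_measurable[OF assms]
  show ?thesis
    unfolding star_discrepancy_le_iff_rat by measurable
qed

text \<open>Counting and volume are both monotone in the box. Comparing the count at
  \<open>x\<close> with that at \<open>b\<close> and the volume at \<open>x\<close> with that at
  \<open>a\<close> bounds the local discrepancy above by its value at \<open>b\<close> plus the
  volume gap; exchanging \<open>a\<close> and \<open>b\<close> gives the lower bound.\<close>

lemma abs_local_discrepancy_bracket:
  fixes a b x :: "real ^ 'd"
  assumes cube: "a \<in> closed_cube" "b \<in> closed_cube" "x \<in> closed_cube"
    and le: "\<And>i. a $ i \<le> x $ i" "\<And>i. x $ i \<le> b $ i"
    and vol: "(\<Prod>i\<in>UNIV. b $ i) - (\<Prod>i\<in>UNIV. a $ i) \<le> \<delta>"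
    and disc: "\<bar>local_discrepancy N P a\<bar> \<le> \<epsilon>" "\<bar>local_discrepancy N P b\<bar> \<le> \<epsilon>"
  shows "\<bar>local_discrepancy N P x\<bar> \<le> \<epsilon> + \<delta>"
proof -
  let ?count = "\<lambda>y. 1 / real N * (\<Sum>j=1..N. indicator (anchored_box y) (P j)) :: real"
  have mono: "?count y \<le> ?count z" if "\<And>i. y $ i \<le> z $ i" for y z :: "real ^ 'd"
    using anchored_box_mono[OF that]
    by (intro mult_left_mono sum_mono) (auto simp: indicator_def)
  have "?count a \<le> ?count x" "?count x \<le> ?count b"
    using le by (blast intro: mono)+
  moreover have "(\<Prod>i\<in>UNIV. a $ i) \<le> (\<Prod>i\<in>UNIV. x $ i)" "(\<Prod>i\<in>UNIV. x $ i) \<le> (\<Prod>i\<in>UNIV. b $ i)"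
    using le cube by (auto intro!: prod_mono simp: closed_cube_def)
  ultimately show ?thesis
    using disc vol unfolding local_discrepancy_def measure_anchored_box[OF cube(1)]
      measure_anchored_box[OF cube(2)] measure_anchored_box[OF cube(3)]
    by linarith
qed

section \<open>Deviation bounds at a single point\<close>

context prob_space
begin

text \<open>Since \<open>s\<close> is nonnegative, all coefficients
  \<open>(exp s - 1) ^ card u\<close> of the subset expansion are nonnegative, so the joint bounds
  can be inserted term by term.\<close>

lemma negatively_dependent_exp_moment:
  fixes E :: "'i \<Rightarrow> 'a set"
  assumes "finite J" and [measurable]: "\<And>j. j \<in> J \<Longrightarrow> E j \<in> events"
    and dep: "\<And>u. u \<subseteq> J \<Longrightarrow> prob {\<omega>\<in>space M. \<forall>j\<in>u. \<omega> \<in> E j} \<le> \<gamma> * q ^ card u"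
    and "0 \<le> s"
  shows "expectation (\<lambda>\<omega>. exp (s * (\<Sum>j\<in>J. indicator (E j) \<omega>))) \<le> \<gamma> * (1 + q * (exp s - 1)) ^ card J"
proof -
  define F where "F u = {\<omega>\<in>space M. \<forall>j\<in>u. \<omega> \<in> E j}" for u
  have F [measurable]: "F u \<in> events" if "u \<subseteq> J" for u
  proof -
    have "finite u" using that \<open>finite J\<close> finite_subset by blast
    then show ?thesis unfolding F_def
      using that by (intro sets.sets_Collect_finite_All) (use assms(2) in auto)
  qed
  have expand: "exp (s * (\<Sum>j\<in>J. indicator (E j) \<omega>)) =
      (\<Sum>u\<in>Pow J. (exp s - 1) ^ card u * indicator (F u) \<omega>)" if "\<omega> \<in> space M" for \<omega>
  proof -
    have "exp (s * (\<Sum>j\<in>J. indicator (E j) \<omega>)) = (\<Prod>j\<in>J. (exp s - 1) * indicator (E j) \<omega> + 1)"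
      unfolding sum_distrib_left exp_sum[OF \<open>finite J\<close>]
      by (intro prod.cong) (auto simp: indicator_def)
    also have "\<dots> = (\<Sum>u\<in>Pow J. (\<Prod>j\<in>u. (exp s - 1) * indicator (E j) \<omega>))"
      using \<open>finite J\<close> by (simp add: prod_add)
    also have "\<dots> = (\<Sum>u\<in>Pow J. (exp s - 1) ^ card u * indicator (F u) \<omega>)"
    proof (rule sum.cong)
      fix u assume "u \<in> Pow J"
      then have "finite u" using \<open>finite J\<close> finite_subset by auto
      then have "(\<Prod>j\<in>u. indicator (E j) \<omega>) = (indicator (F u) \<omega> :: real)"
        using that by (induction u) (auto simp: F_def indicator_def)
      then show "(\<Prod>j\<in>u. (exp s - 1) * indicator (E j) \<omega>) = (exp s - 1) ^ card u * indicator (F u) \<omega>"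
        by (simp add: prod.distrib)
    qed simp
    finally show ?thesis .
  qed
  have "expectation (\<lambda>\<omega>. exp (s * (\<Sum>j\<in>J. indicator (E j) \<omega>))) =
      expectation (\<lambda>\<omega>. \<Sum>u\<in>Pow J. (exp s - 1) ^ card u * indicator (F u) \<omega>)"
    by (rule Bochner_Integration.integral_cong) (auto simp: expand)
  also have "\<dots> = (\<Sum>u\<in>Pow J. (exp s - 1) ^ card u * prob (F u))"
    by (subst Bochner_Integration.integral_sum)
       (auto intro!: integrable_real_indicator simp: emeasure_eq_measure)
  also have "\<dots> \<le> (\<Sum>u\<in>Pow J. (exp s - 1) ^ card u * (\<gamma> * q ^ card u))"
    using dep \<open>0 \<le> s\<close> unfolding F_def by (intro sum_mono mult_left_mono) auto
  \<comment> \<open>The same product expansion, read backwards with constant factors.\<close>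
  also have "\<dots> = \<gamma> * (\<Prod>j\<in>J. q * (exp s - 1) + 1)"
    unfolding prod_add[OF \<open>finite J\<close>] by (simp add: sum_distrib_left power_mult_distrib mult_ac)
  also have "\<dots> = \<gamma> * (1 + q * (exp s - 1)) ^ card J"
    by (simp add: add.commute)
  finally show ?thesis .
qed

lemma negatively_dependent_Hoeffding:
  fixes E :: "'i \<Rightarrow> 'a set"
  assumes "finite J" and [measurable]: "\<And>j. j \<in> J \<Longrightarrow> E j \<in> events"
    and dep: "\<And>u. u \<subseteq> J \<Longrightarrow> prob {\<omega>\<in>space M. \<forall>j\<in>u. \<omega> \<in> E j} \<le> \<gamma> * q ^ card u"
    and "0 \<le> q" "0 \<le> \<gamma>" "0 < t"
  shows "prob {\<omega>\<in>space M. (\<Sum>j\<in>J. indicator (E j) \<omega>) \<ge> real (card J) * (q + t)}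
      \<le> \<gamma> * exp (- 2 * real (card J) * t\<^sup>2)"
proof -
  \<comment> \<open>The value \<open>4 * t\<close> minimises the Chernoff exponent
    \<open>- s * t + s^2 / 8\<close> per summand; the minimum is \<open>- 2 * t^2\<close>.\<close>
  let ?S = "\<lambda>\<omega>. \<Sum>j\<in>J. indicator (E j) \<omega> :: real" and ?n = "card J" and ?s = "4 * t"
  have S_le: "?S \<omega> \<le> ?n" for \<omega>
    using sum_bounded_above[of J "\<lambda>j. indicator (E j) \<omega>" "1::real"] by (simp add: indicator_le_1)
  have int: "integrable M (\<lambda>\<omega>. exp (?s * ?S \<omega>))"
    using S_le \<open>0 < t\<close> by (intro integrable_const_bound[where B = "exp (?s * ?n)"]) auto
  have pos: "0 < 1 + q * (exp ?s - 1)"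
    using \<open>0 \<le> q\<close> \<open>0 < t\<close> by (intro add_pos_nonneg mult_nonneg_nonneg) auto
  have "1 + q * (exp ?s - 1) = exp (ln (1 + q * (exp ?s - 1)))"
    using pos by simp
  also have "\<dots> \<le> exp (?s * q + ?s\<^sup>2 / 8)"
    using Hoeffdings_lemma_aux[of ?s q] \<open>0 \<le> q\<close> \<open>0 < t\<close> unfolding exp_le_cancel_iff by linarith
  finally have moment: "1 + q * (exp ?s - 1) \<le> exp (?s * q + ?s\<^sup>2 / 8)" .
  have "prob {\<omega>\<in>space M. ?S \<omega> \<ge> ?n * (q + t)} \<le>
      exp (- ?s * (?n * (q + t))) * (\<integral>\<omega>\<in>space M. exp (?s * ?S \<omega>) \<partial>M)"
    using integrable_mult_indicator[OF sets.top int] \<open>0 < t\<close>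
    by (intro Chernoff_ineq_ge) (auto simp: set_integrable_def)
  also have "(\<integral>\<omega>\<in>space M. exp (?s * ?S \<omega>) \<partial>M) = expectation (\<lambda>\<omega>. exp (?s * ?S \<omega>))"
    by (rule set_integral_space[OF int])
  also have "\<dots> \<le> \<gamma> * (1 + q * (exp ?s - 1)) ^ ?n"
    using assms by (intro negatively_dependent_exp_moment) auto
  also have "\<dots> \<le> \<gamma> * exp (?s * q + ?s\<^sup>2 / 8) ^ ?n"
    using moment pos \<open>0 \<le> \<gamma>\<close> by (intro mult_left_mono power_mono) auto
  also have "exp (- ?s * (?n * (q + t))) * (\<gamma> * exp (?s * q + ?s\<^sup>2 / 8) ^ ?n) =
      \<gamma> * exp (- ?s * (?n * (q + t)) + ?n * (?s * q + ?s\<^sup>2 / 8))"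
    unfolding exp_of_nat_mult[symmetric] unfolding exp_add by simp
  also have "- ?s * (?n * (q + t)) + ?n * (?s * q + ?s\<^sup>2 / 8) = - 2 * real ?n * t\<^sup>2"
    by (simp add: algebra_simps power2_eq_square)
  finally show ?thesis by simp
qed

text \<open>Too many points in the box is an upper deviation of the events \<open>E j\<close>; too
  few is an upper deviation of the complements \<open>F j\<close>, whose probability is
  \<open>1 - v\<close>. The two halves of negative dependence serve these two cases, whence the
  factor 2.\<close>

lemma local_discrepancy_tail_half_open:
  fixes p :: "nat \<Rightarrow> 'a \<Rightarrow> real ^ 'd"
  assumes scheme: "neg_dependent_scheme M N anchored_boxes \<gamma> p"
    and "1 \<le> N" "a \<in> half_open_cube" "0 < t"
  shows "prob {\<omega>\<in>space M. t \<le> \<bar>local_discrepancy N (\<lambda>j. p j \<omega>) a\<bar>} \<le> 2 * \<gamma> * exp (- 2 * real N * t\<^sup>2)"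
proof -
  let ?Q = "anchored_box a"
  define v where "v = (\<Prod>i\<in>UNIV. a $ i)"
  define E where "E j = {\<omega>\<in>space M. p j \<omega> \<in> ?Q}" for j
  define F where "F j = {\<omega>\<in>space M. p j \<omega> \<notin> ?Q}" for j
  have cube: "a \<in> closed_cube"
    using assms(3) by (auto simp: half_open_cube_def closed_cube_def less_imp_le)
  have v: "0 \<le> v" "v \<le> 1"
    using cube by (auto simp: v_def closed_cube_def intro!: prod_nonneg prod_le_1)
  have p: "p j \<in> borel_measurable M"
      "distr M borel (p j) = uniform_measure lborel half_open_cube" if "j \<in> {1..N}" for j
    using scheme that by (auto simp: neg_dependent_scheme_def sampling_scheme_def)
  have nd: "negatively_dependent M N \<gamma> (\<lambda>j \<omega>. indicator ?Q (p j \<omega>))"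
    using scheme assms(3) by (auto simp: neg_dependent_scheme_def anchored_boxes_def)
  then have "1 \<le> \<gamma>" by (simp add: negatively_dependent_def)
  have E [measurable]: "E j \<in> events" and F [measurable]: "F j \<in> events" if "j \<in> {1..N}" for j
    unfolding E_def F_def using p(1)[OF that] by measurable
  have prob_E: "prob (E j) = v" if "j \<in> {1..N}" for j
  proof -
    have "prob (E j) = measure (distr M borel (p j)) ?Q"
      unfolding measure_distr[OF p(1)[OF that] anchored_box_borel] E_def
      by (intro arg_cong[where f = prob]) auto
    then show ?thesis
      unfolding p(2)[OF that] measure_uniform_anchored_box[OF cube] v_def .
  qed
  have prob_F: "prob (F j) = 1 - v" if "j \<in> {1..N}" for j
  proof -
    have "F j = space M - E j" by (auto simp: E_def F_def)
    then show ?thesis using prob_compl[OF E[OF that]] prob_E[OF that] by simp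
  qed
  have dep: "prob {\<omega>\<in>space M. \<forall>j\<in>u. \<omega> \<in> E j} \<le> \<gamma> * v ^ card u"
      "prob {\<omega>\<in>space M. \<forall>j\<in>u. \<omega> \<in> F j} \<le> \<gamma> * (1 - v) ^ card u" if "u \<subseteq> {1..N}" for u
  proof -
    have ind: "(indicator ?Q z = (1::real)) = (z \<in> ?Q)" "(indicator ?Q z = (0::real)) = (z \<notin> ?Q)" for z
      by (auto simp: indicator_def)
    have nd': "prob {\<omega>\<in>space M. \<forall>j\<in>u. p j \<omega> \<in> ?Q} \<le> \<gamma> * (\<Prod>j\<in>u. prob (E j))"
        "prob {\<omega>\<in>space M. \<forall>j\<in>u. p j \<omega> \<notin> ?Q} \<le> \<gamma> * (\<Prod>j\<in>u. prob (F j))"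
      using nd that unfolding negatively_dependent_def ind E_def F_def by blast+
    have "(\<Prod>j\<in>u. prob (E j)) = v ^ card u" "(\<Prod>j\<in>u. prob (F j)) = (1 - v) ^ card u"
      using that prob_E prob_F by (auto simp: subset_iff)
    moreover have "{\<omega>\<in>space M. \<forall>j\<in>u. \<omega> \<in> E j} = {\<omega>\<in>space M. \<forall>j\<in>u. p j \<omega> \<in> ?Q}"
        "{\<omega>\<in>space M. \<forall>j\<in>u. \<omega> \<in> F j} = {\<omega>\<in>space M. \<forall>j\<in>u. p j \<omega> \<notin> ?Q}"
      by (auto simp: E_def F_def)
    ultimately show "prob {\<omega>\<in>space M. \<forall>j\<in>u. \<omega> \<in> E j} \<le> \<gamma> * v ^ card u"
      "prob {\<omega>\<in>space M. \<forall>j\<in>u. \<omega> \<in> F j} \<le> \<gamma> * (1 - v) ^ card u"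
      using nd' by simp_all
  qed
  define U where "U = {\<omega>\<in>space M. (\<Sum>j\<in>{1..N}. indicator (E j) \<omega>) \<ge> real N * (v + t)}"
  define L where "L = {\<omega>\<in>space M. (\<Sum>j\<in>{1..N}. indicator (F j) \<omega>) \<ge> real N * (1 - v + t)}"
  have UL [measurable]: "U \<in> events" "L \<in> events"
    unfolding U_def L_def by measurable
  have "prob U \<le> \<gamma> * exp (- 2 * real N * t\<^sup>2)"
    using negatively_dependent_Hoeffding[of "{1..N}" E \<gamma> v t] dep(1) v \<open>1 \<le> \<gamma>\<close> \<open>0 < t\<close> E
    by (simp add: U_def)
  moreover have "prob L \<le> \<gamma> * exp (- 2 * real N * t\<^sup>2)"
    using negatively_dependent_Hoeffding[of "{1..N}" F \<gamma> "1 - v" t] dep(2) v \<open>1 \<le> \<gamma>\<close> \<open>0 < t\<close> F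
    by (simp add: L_def)
  moreover have "{\<omega>\<in>space M. t \<le> \<bar>local_discrepancy N (\<lambda>j. p j \<omega>) a\<bar>} \<subseteq> U \<union> L"
  proof (rule subsetI)
    fix \<omega> assume "\<omega> \<in> {\<omega>\<in>space M. t \<le> \<bar>local_discrepancy N (\<lambda>j. p j \<omega>) a\<bar>}"
    then have \<omega>: "\<omega> \<in> space M" and t: "t \<le> \<bar>local_discrepancy N (\<lambda>j. p j \<omega>) a\<bar>" by auto
    define S where "S = (\<Sum>j=1..N. indicator ?Q (p j \<omega>) :: real)"
    have S_E: "(\<Sum>j\<in>{1..N}. indicator (E j) \<omega>) = S"
      unfolding S_def using \<omega> by (intro sum.cong) (auto simp: E_def indicator_def)
    have "(\<Sum>j\<in>{1..N}. indicator (F j) \<omega>) = (\<Sum>j=1..N. 1 - indicator ?Q (p j \<omega>) :: real)"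
      using \<omega> by (intro sum.cong) (auto simp: F_def indicator_def)
    then have S_F: "(\<Sum>j\<in>{1..N}. indicator (F j) \<omega>) = real N - S"
      unfolding S_def sum_subtractf by simp
    have "v + t \<le> S / real N \<or> S / real N \<le> v - t"
      using t unfolding local_discrepancy_def measure_anchored_box[OF cube] v_def[symmetric] S_def[symmetric]
      by (auto simp: abs_if split: if_splits)
    then have "real N * (v + t) \<le> S \<or> S \<le> real N * (v - t)"
      using \<open>1 \<le> N\<close> by (simp add: field_simps)
    then have "real N * (v + t) \<le> S \<or> real N * (1 - v + t) \<le> real N - S"
      by (simp add: algebra_simps)
    then show "\<omega> \<in> U \<union> L"
      using \<omega> unfolding U_def L_def by (simp only: Un_iff mem_Collect_eq S_E S_F simp_thms)
  qed
  then have "prob {\<omega>\<in>space M. t \<le> \<bar>local_discrepancy N (\<lambda>j. p j \<omega>) a\<bar>} \<le> prob (U \<union> L)"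
    by (intro finite_measure_mono) auto
  moreover have "prob (U \<union> L) \<le> prob U + prob L"
    by (intro measure_Un_le) auto
  ultimately show ?thesis by simp
qed

text \<open>Boxes with some side equal to \<open>1\<close> are not in \<^const>\<open>anchored_boxes\<close>; they are
  approximated from inside, which is why the event has a strict inequality.\<close>

lemma local_discrepancy_tail:
  fixes p :: "nat \<Rightarrow> 'a \<Rightarrow> real ^ 'd"
  assumes scheme: "neg_dependent_scheme M N anchored_boxes \<gamma> p"
    and "1 \<le> N" "b \<in> closed_cube" "0 < t"
  shows "prob {\<omega>\<in>space M. t < \<bar>local_discrepancy N (\<lambda>j. p j \<omega>) b\<bar>} \<le> 2 * \<gamma> * exp (- 2 * real N * t\<^sup>2)"
proof -
  \<comment> \<open>Shrinking by a factor below 1 makes every coordinate less than 1 even where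
    \<open>b\<close> has a coordinate 1.\<close>
  define y :: "nat \<Rightarrow> real ^ 'd" where "y n = (\<chi> i. b $ i * (1 - 1 / real (Suc n)))" for n
  have b: "0 \<le> b $ i" "b $ i \<le> 1" for i
    using assms(3) by (auto simp: closed_cube_def)
  have factor: "0 \<le> 1 - 1 / real (Suc n)" "1 - 1 / real (Suc n) < 1" for n
    by auto
  have y_nonneg: "0 \<le> y n $ i" for n i
    using b(1)[of i] factor(1)[of n] unfolding y_def vec_lambda_beta by (rule mult_nonneg_nonneg)
  have y_le: "y n $ i \<le> b $ i" for n i
    using mult_left_mono[OF less_imp_le[OF factor(2)[of n]] b(1)[of i]] by (simp add: y_def)
  have "y n $ i < 1" for n i
  proof -
    have "b $ i * (1 - 1 / real (Suc n)) \<le> 1 * (1 - 1 / real (Suc n))"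
      by (rule mult_right_mono[OF b(2) factor(1)])
    then show ?thesis
      unfolding y_def vec_lambda_beta mult_1 using factor(2) by (rule le_less_trans)
  qed
  then have y_cube: "y n \<in> half_open_cube" for n
    using y_nonneg by (auto simp: half_open_cube_def)
  have "(\<lambda>n. b $ i * (1 - 1 / real (Suc n))) \<longlonglongrightarrow> b $ i * (1 - 0)" for i
    by (intro tendsto_mult tendsto_diff tendsto_const LIMSEQ_Suc[OF lim_inverse_n'])
  then have y_lim: "(\<lambda>n. y n $ i) \<longlonglongrightarrow> b $ i" for i
    by (simp add: y_def)
  have meas [measurable]: "(\<lambda>\<omega>. local_discrepancy N (\<lambda>j. p j \<omega>) x) \<in> borel_measurable M" for x
    using scheme by (intro local_discrepancy_measurable) (auto simp: neg_dependent_scheme_def sampling_scheme_def)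
  define A where "A n = {\<omega>\<in>space M. t \<le> \<bar>local_discrepancy N (\<lambda>j. p j \<omega>) (y n)\<bar>}" for n
  have A [measurable]: "A n \<in> events" for n
    unfolding A_def by measurable
  \<comment> \<open>The lower limit of the sets \<open>A k\<close> is an increasing union of sets
    each contained in some \<open>A n\<close>, so it inherits their common bound by continuity from
    below. The strict inequality at \<open>b\<close> places the target event inside this lower
    limit.\<close>
  have "incseq (\<lambda>n. \<Inter>k\<in>{n..}. A k)"
    by (auto simp: incseq_def)
  moreover have B: "(\<Inter>k\<in>{n..}. A k) \<in> events" for n
    by (intro sets.countable_INT') auto
  ultimately have "(\<lambda>n. prob (\<Inter>k\<in>{n..}. A k)) \<longlonglongrightarrow> prob (\<Union>n. \<Inter>k\<in>{n..}. A k)"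
    by (intro finite_Lim_measure_incseq) auto
  moreover have "prob (\<Inter>k\<in>{n..}. A k) \<le> 2 * \<gamma> * exp (- 2 * real N * t\<^sup>2)" for n
  proof -
    have "prob (\<Inter>k\<in>{n..}. A k) \<le> prob (A n)"
      by (intro finite_measure_mono) auto
    also have "\<dots> \<le> 2 * \<gamma> * exp (- 2 * real N * t\<^sup>2)"
      unfolding A_def using scheme \<open>1 \<le> N\<close> y_cube \<open>0 < t\<close> by (rule local_discrepancy_tail_half_open)
    finally show ?thesis .
  qed
  ultimately have "prob (\<Union>n. \<Inter>k\<in>{n..}. A k) \<le> 2 * \<gamma> * exp (- 2 * real N * t\<^sup>2)"
    by (intro LIMSEQ_le_const2) auto
  moreover have "{\<omega>\<in>space M. t < \<bar>local_discrepancy N (\<lambda>j. p j \<omega>) b\<bar>} \<subseteq> (\<Union>n. \<Inter>k\<in>{n..}. A k)"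
  proof (rule subsetI)
    fix \<omega> assume "\<omega> \<in> {\<omega>\<in>space M. t < \<bar>local_discrepancy N (\<lambda>j. p j \<omega>) b\<bar>}"
    then have \<omega>: "\<omega> \<in> space M" and t: "t < \<bar>local_discrepancy N (\<lambda>j. p j \<omega>) b\<bar>" by auto
    have "(\<lambda>n. \<bar>local_discrepancy N (\<lambda>j. p j \<omega>) (y n)\<bar>) \<longlonglongrightarrow> \<bar>local_discrepancy N (\<lambda>j. p j \<omega>) b\<bar>"
      using assms(3) y_nonneg y_le y_lim by (intro tendsto_rabs local_discrepancy_left_tendsto)
    from order_tendstoD(1)[OF this t] obtain n
      where "\<And>k. n \<le> k \<Longrightarrow> t < \<bar>local_discrepancy N (\<lambda>j. p j \<omega>) (y k)\<bar>"
      by (auto simp: eventually_sequentially)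
    then have "\<omega> \<in> (\<Inter>k\<in>{n..}. A k)"
      using \<omega> by (auto simp: A_def less_imp_le)
    then show "\<omega> \<in> (\<Union>n. \<Inter>k\<in>{n..}. A k)" by blast
  qed
  then have "prob {\<omega>\<in>space M. t < \<bar>local_discrepancy N (\<lambda>j. p j \<omega>) b\<bar>} \<le> prob (\<Union>n. \<Inter>k\<in>{n..}. A k)"
    using B by (intro finite_measure_mono) auto
  ultimately show ?thesis by linarith
qed

section \<open>Union bound over the end points of the cover\<close>

lemma star_discrepancy_tail:
  fixes p :: "nat \<Rightarrow> 'a \<Rightarrow> real ^ 'd"
  assumes scheme: "neg_dependent_scheme M N anchored_boxes \<gamma> p"
    and "1 \<le> N" "0 < \<delta>" "0 \<le> \<gamma>"
  shows "prob {\<omega>\<in>space M. star_discrepancy N (\<lambda>j. p j \<omega>) \<le> 2 * \<delta>}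
    \<ge> 1 - 2 * \<gamma> * (2 * exp 1 * (1 / \<delta> + 1)) ^ CARD('d) * exp (- 2 * real N * \<delta>\<^sup>2)"
proof -
  let ?d = "CARD('d)"
  define m where "m = nat \<lceil>real ?d / \<delta>\<rceil>"
  have "0 < real ?d / \<delta>" using \<open>0 < \<delta>\<close> by simp
  then have "0 < m" and m: "real ?d / \<delta> \<le> real m"
    unfolding m_def by linarith+
  have mesh: "real ?d / real m \<le> \<delta>"
    using m \<open>0 < m\<close> \<open>0 < \<delta>\<close> by (simp add: field_simps)
  obtain B :: "(('d \<Rightarrow> real) \<times> ('d \<Rightarrow> real)) set" where "finite B"
    and card_B: "card B \<le> (m + ?d - 1) choose ?d"
    and cover: "\<And>x. (\<forall>i. 0 \<le> x i \<and> x i \<le> 1) \<Longrightarrow>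
      \<exists>c\<in>B. brackets c UNIV x \<and> prod (snd c) UNIV - prod (fst c) UNIV \<le> real ?d / real m"
    using bracketing_cover[of "UNIV :: 'd set" m] \<open>0 < m\<close> by auto
  define lo hi :: "('d \<Rightarrow> real) \<times> ('d \<Rightarrow> real) \<Rightarrow> real ^ 'd"
    where "lo c = (\<chi> i. fst c i)" and "hi c = (\<chi> i. snd c i)" for c
  define G where "G = (lo ` B \<union> hi ` B) \<inter> closed_cube"
  have "finite G" using \<open>finite B\<close> by (simp add: G_def)
  have meas [measurable]: "(\<lambda>\<omega>. local_discrepancy N (\<lambda>j. p j \<omega>) x) \<in> borel_measurable M" for x
    using scheme by (intro local_discrepancy_measurable) (auto simp: neg_dependent_scheme_def sampling_scheme_def)
  define bad where "bad x = {\<omega>\<in>space M. \<delta> < \<bar>local_discrepancy N (\<lambda>j. p j \<omega>) x\<bar>}" for x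
  have bad [measurable]: "bad x \<in> events" for x
    unfolding bad_def by measurable
  define good where "good = {\<omega>\<in>space M. star_discrepancy N (\<lambda>j. p j \<omega>) \<le> 2 * \<delta>}"
  have "good \<in> events"
    unfolding good_def using scheme
    by (intro star_discrepancy_le_sets) (auto simp: neg_dependent_scheme_def sampling_scheme_def)
  have sub: "space M - good \<subseteq> (\<Union>x\<in>G. bad x)"
  proof (rule subsetI, rule ccontr)
    fix \<omega> assume \<omega>: "\<omega> \<in> space M - good" and "\<omega> \<notin> (\<Union>x\<in>G. bad x)"
    then have G: "\<bar>local_discrepancy N (\<lambda>j. p j \<omega>) y\<bar> \<le> \<delta>" if "y \<in> G" for y
      using that by (force simp: bad_def not_less)
    have "\<bar>local_discrepancy N (\<lambda>j. p j \<omega>) x\<bar> \<le> \<delta> + \<delta>" if x: "x \<in> closed_cube" for x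
    proof -
      obtain c where c: "c \<in> B" "brackets c UNIV (($) x)"
          "prod (snd c) UNIV - prod (fst c) UNIV \<le> real ?d / real m"
        using cover[of "($) x"] x by (auto simp: closed_cube_def)
      have le: "lo c $ i \<le> x $ i" "x $ i \<le> hi c $ i" "0 \<le> lo c $ i" "hi c $ i \<le> 1" for i
        using c(2) by (auto simp: brackets_def lo_def hi_def)
      have "lo c \<in> closed_cube"
        using x le(3) le(1) by (rule closed_cube_downward)
      moreover have "0 \<le> hi c $ i" for i
        using le(1-3)[of i] by linarith
      then have "hi c \<in> closed_cube"
        using le(4) by (simp add: closed_cube_def)
      ultimately have cube: "lo c \<in> closed_cube" "hi c \<in> closed_cube" .
      have "(\<Prod>i\<in>UNIV. hi c $ i) - (\<Prod>i\<in>UNIV. lo c $ i) \<le> \<delta>"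
        using c(3) mesh by (simp add: lo_def hi_def)
      then show ?thesis
        using c(1) cube x le G unfolding G_def
        by (intro abs_local_discrepancy_bracket[of "lo c" "hi c"]) auto
    qed
    then have "\<omega> \<in> good"
      using \<omega> by (simp add: good_def star_discrepancy_le_iff)
    with \<omega> show False by blast
  qed
  have "card G \<le> card (lo ` B \<union> hi ` B)"
    unfolding G_def using \<open>finite B\<close> by (intro card_mono) auto
  also have "\<dots> \<le> card B + card B"
    by (intro order_trans[OF card_Un_le] add_mono card_image_le \<open>finite B\<close>)
  finally have "real (card G) \<le> 2 * real ((m + ?d - 1) choose ?d)"
    using card_B by linarith
  \<comment> \<open>Each bracket has two end points; this 2 is absorbed into \<open>2 ^ d\<close>,
    as the dimension is at least 1.\<close>
  also have "\<dots> \<le> 2 ^ ?d * (exp 1 * (1 / \<delta> + 1)) ^ ?d"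
    using binomial_le_exp_power[OF \<open>0 < \<delta>\<close>, of ?d] self_le_power[of "2::real" ?d] unfolding m_def
    by (intro mult_mono) auto
  also have "\<dots> = (2 * exp 1 * (1 / \<delta> + 1)) ^ ?d"
    by (simp only: power_mult_distrib mult.assoc)
  finally have card_G: "real (card G) \<le> (2 * exp 1 * (1 / \<delta> + 1)) ^ ?d" .
  have "1 - prob good = prob (space M - good)"
    using prob_compl[OF \<open>good \<in> events\<close>] by simp
  also have "\<dots> \<le> prob (\<Union>x\<in>G. bad x)"
    using sub \<open>finite G\<close> by (intro finite_measure_mono sets.finite_UN) auto
  also have "\<dots> \<le> (\<Sum>x\<in>G. prob (bad x))"
    using \<open>finite G\<close> by (intro finite_measure_subadditive_finite) auto
  also have "\<dots> \<le> (\<Sum>x\<in>G. 2 * \<gamma> * exp (- 2 * real N * \<delta>\<^sup>2))"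
    unfolding bad_def using scheme \<open>1 \<le> N\<close> \<open>0 < \<delta>\<close>
    by (intro sum_mono local_discrepancy_tail) (auto simp: G_def)
  also have "\<dots> = real (card G) * (2 * \<gamma> * exp (- 2 * real N * \<delta>\<^sup>2))"
    by simp
  also have "\<dots> \<le> (2 * exp 1 * (1 / \<delta> + 1)) ^ ?d * (2 * \<gamma> * exp (- 2 * real N * \<delta>\<^sup>2))"
    using card_G \<open>0 \<le> \<gamma>\<close> by (intro mult_right_mono) auto
  finally show ?thesis
    unfolding good_def by (simp add: mult_ac)
qed

end

section \<open>The two choices of \<open>\<delta>\<close> in the tail estimate\<close>

theorem theorem3p1:
  fixes M :: "'w measure" and d N :: nat and \<rho> :: real
    and p :: "nat \<Rightarrow> 'w \<Rightarrow> real ^ 'd"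
  assumes "prob_space M"
    and "d = CARD('d)" and "N \<ge> 1" and "\<rho> \<ge> 0"
    and "neg_dependent_scheme M N anchored_boxes (exp (\<rho> * real d)) p"
  shows "(\<forall>c::real. c > 0 \<longrightarrow>
            measure M {\<omega>\<in>space M. star_discrepancy N (\<lambda>j. p j \<omega>)
                \<le> c * sqrt (real d / real N * max 1 (ln (real N / real d)))}
              \<ge> 1 - 2 * exp ((- (1/2) * (c^2 - 1) * xi N d + \<rho>
                               + ln (2 * exp 1 * (2 / c + 1))) * real d)) \<and>
         (\<forall>\<theta>::real. 0 < \<theta> \<and> \<theta> < 1 \<longrightarrow>
            measure M {\<omega>\<in>space M. star_discrepancy N (\<lambda>j. p j \<omega>)
                \<le> sqrt (2 / real N)
                   * sqrt (real d * ln (eta N d) + \<rho> * real d + ln (2 / (1 - \<theta>)))}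
              \<ge> \<theta>)"
proof -
  interpret prob_space M by fact
  have "0 < d" "0 < N" using assms(2,3) by auto
  note tail = star_discrepancy_tail[OF assms(5,3) _ exp_ge_zero, folded assms(2)]
  have "measure M {\<omega>\<in>space M. star_discrepancy N (\<lambda>j. p j \<omega>)
                \<le> c * sqrt (real d / real N * max 1 (ln (real N / real d)))}
              \<ge> 1 - 2 * exp ((- (1/2) * (c^2 - 1) * xi N d + \<rho>
                               + ln (2 * exp 1 * (2 / c + 1))) * real d)"
    if "0 < c" for c :: real
  proof -
    define \<xi> where "\<xi> = xi N d"
    have \<xi>: "1 \<le> \<xi>" "ln (real N / real d) \<le> \<xi>"
      by (auto simp: \<xi>_def xi_def)
    \<comment> \<open>Half of the claimed bound, because the tail estimate concerns
      \<open>2 * \<delta>\<close>.\<close>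
    define \<delta> where "\<delta> = c / 2 * sqrt (real d / real N * \<xi>)"
    have "0 < \<delta>"
      using \<open>0 < c\<close> \<open>0 < d\<close> \<open>0 < N\<close> \<xi>(1) by (simp add: \<delta>_def)
    \<comment> \<open>The aim is to bound \<open>1 / \<delta> + 1\<close> by
      \<open>(2 / c + 1) * exp (\<xi> / 2)\<close>. The cover then contributes
      \<open>\<xi> * d / 2\<close> to the exponent, which turns \<open>c^2\<close> into
      \<open>c^2 - 1\<close>.\<close>
    have "exp (ln (real N / real d)) \<le> exp \<xi>"
      using \<xi>(2) by (rule iffD2[OF exp_le_cancel_iff])
    then have "real N / real d \<le> exp \<xi>"
      using \<open>0 < d\<close> \<open>0 < N\<close> by simp
    also have "\<dots> \<le> exp \<xi> * \<xi>"
      using \<xi>(1) by simp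
    finally have "real N / (real d * \<xi>) \<le> exp \<xi>"
      using \<open>0 < d\<close> \<xi>(1) by (simp add: field_simps)
    also have "exp \<xi> = (exp (\<xi> / 2))\<^sup>2"
      by (simp add: exp_double[symmetric])
    finally have "sqrt (real N / (real d * \<xi>)) \<le> exp (\<xi> / 2)"
      by (simp add: real_le_lsqrt)
    then have "2 / c * sqrt (real N / (real d * \<xi>)) \<le> 2 / c * exp (\<xi> / 2)"
      using \<open>0 < c\<close> by (intro mult_left_mono) auto
    moreover have "1 / \<delta> = 2 / c * sqrt (real N / (real d * \<xi>))"
      by (simp add: \<delta>_def real_sqrt_divide real_sqrt_mult)
    moreover have "1 \<le> exp (\<xi> / 2)"
      using \<xi>(1) by simp
    ultimately have "1 / \<delta> + 1 \<le> (2 / c + 1) * exp (\<xi> / 2)"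
      unfolding distrib_right by linarith
    then have "(2 * exp 1 * (1 / \<delta> + 1)) ^ d \<le> (2 * exp 1 * ((2 / c + 1) * exp (\<xi> / 2))) ^ d"
      using \<open>0 < \<delta>\<close> by (intro power_mono mult_left_mono) auto
    also have "\<dots> = exp (ln (2 * exp 1 * (2 / c + 1)) + \<xi> / 2) ^ d"
      using \<open>0 < c\<close> by (simp add: exp_add add_pos_pos mult.assoc)
    also have "\<dots> = exp (real d * (ln (2 * exp 1 * (2 / c + 1)) + \<xi> / 2))"
      by (rule exp_of_nat_mult[symmetric])
    finally have card: "(2 * exp 1 * (1 / \<delta> + 1)) ^ d
        \<le> exp (real d * (ln (2 * exp 1 * (2 / c + 1)) + \<xi> / 2))" .
    have "\<delta>\<^sup>2 = c\<^sup>2 / 4 * (real d / real N * \<xi>)"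
      using \<xi>(1) by (simp add: \<delta>_def power_mult_distrib power_divide)
    then have exponent: "- 2 * real N * \<delta>\<^sup>2 = - (1/2) * c\<^sup>2 * \<xi> * real d"
      using \<open>0 < N\<close> by simp
    have "2 * exp (\<rho> * real d) * (2 * exp 1 * (1 / \<delta> + 1)) ^ d * exp (- 2 * real N * \<delta>\<^sup>2)
        \<le> 2 * exp (\<rho> * real d) * exp (real d * (ln (2 * exp 1 * (2 / c + 1)) + \<xi> / 2))
          * exp (- 2 * real N * \<delta>\<^sup>2)"
      using card by (intro mult_right_mono mult_left_mono) auto
    also have "\<dots> = 2 * exp (\<rho> * real d + real d * (ln (2 * exp 1 * (2 / c + 1)) + \<xi> / 2)
          + - (1/2) * c\<^sup>2 * \<xi> * real d)"
      unfolding exponent exp_add by simp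
    also have "\<rho> * real d + real d * (ln (2 * exp 1 * (2 / c + 1)) + \<xi> / 2) + - (1/2) * c\<^sup>2 * \<xi> * real d
        = (- (1/2) * (c^2 - 1) * xi N d + \<rho> + ln (2 * exp 1 * (2 / c + 1))) * real d"
      unfolding \<xi>_def by (simp add: field_simps)
    finally have "1 - 2 * exp ((- (1/2) * (c^2 - 1) * xi N d + \<rho> + ln (2 * exp 1 * (2 / c + 1))) * real d)
        \<le> prob {\<omega>\<in>space M. star_discrepancy N (\<lambda>j. p j \<omega>) \<le> 2 * \<delta>}"
      using tail[OF \<open>0 < \<delta>\<close>] by linarith
    then show ?thesis
      by (simp add: \<delta>_def \<xi>_def xi_def)
  qed
  moreover have "measure M {\<omega>\<in>space M. star_discrepancy N (\<lambda>j. p j \<omega>)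
                \<le> sqrt (2 / real N)
                   * sqrt (real d * ln (eta N d) + \<rho> * real d + ln (2 / (1 - \<theta>)))}
              \<ge> \<theta>"
    if \<theta>: "0 < \<theta> \<and> \<theta> < 1" for \<theta> :: real
  proof -
    define X where "X = max 1 (real N / (2 * real d * ln (6 * exp 1)))"
    define L where "L = real d * ln (eta N d) + \<rho> * real d + ln (2 / (1 - \<theta>))"
    \<comment> \<open>Again half of the bound; now \<open>2 * N * \<delta>^2 = L\<close>
      exactly.\<close>
    define \<delta> where "\<delta> = sqrt (2 / real N) * sqrt L / 2"
    have "1 \<le> X" by (simp add: X_def)
    have eta: "eta N d = 6 * exp 1 * sqrt X"
      using \<open>1 \<le> X\<close> by (simp add: eta_def X_def powr_half_sqrt)
    have "6 * exp 1 * 1 \<le> eta N d"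
      unfolding eta using \<open>1 \<le> X\<close> by (intro mult_left_mono) auto
    then have eta_ge: "6 * exp 1 \<le> eta N d" by simp
    have "0 < eta N d"
      using eta_ge exp_gt_zero[of "1::real"] by linarith
    have ln6e: "0 < ln (6 * exp 1 :: real)"
      by (simp add: ln_mult add_pos_pos)
    have ln_eta: "ln (6 * exp 1) \<le> ln (eta N d)"
      using eta_ge \<open>0 < eta N d\<close> by (subst ln_le_cancel_iff) auto
    have "0 \<le> ln (2 / (1 - \<theta>))"
      using \<theta> by (intro ln_ge_zero) (auto simp: field_simps)
    \<comment> \<open>\<open>\<delta>\<close> depends on \<open>eta\<close>, yet \<open>eta\<close>
      must dominate the cover factor \<open>2 * exp 1 * (1 / \<delta> + 1)\<close>. The crude bound
      \<open>eta \<ge> 6 * exp 1\<close> breaks this circle: it bounds \<open>L\<close> from below,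
      hence \<open>1 / \<delta>\<close> from above by \<open>2 * sqrt X\<close>.\<close>
    then have L_ge: "real d * ln (6 * exp 1) \<le> L"
      unfolding L_def using mult_left_mono[OF ln_eta, of "real d"] assms(4)
      by (simp add: add_increasing2)
    then have "0 < L"
      using mult_pos_pos[of "real d" "ln (6 * exp 1)"] ln6e \<open>0 < d\<close> by linarith
    then have "0 < \<delta>"
      using \<open>0 < N\<close> by (simp add: \<delta>_def)
    have "1 / \<delta> = sqrt (2 * real N / L)"
    proof (rule real_sqrt_unique[symmetric])
      show "(1 / \<delta>)\<^sup>2 = 2 * real N / L"
        using \<open>0 < L\<close> by (simp add: \<delta>_def power_divide power_mult_distrib)
    qed (use \<open>0 < \<delta>\<close> in simp)
    also have "\<dots> \<le> sqrt (4 * X)"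
    proof (rule real_sqrt_le_mono)
      have "2 * real N / L \<le> 2 * real N / (real d * ln (6 * exp 1))"
        using L_ge ln6e \<open>0 < d\<close> by (intro divide_left_mono) (auto intro: mult_pos_pos \<open>0 < L\<close>)
      also have "\<dots> = 4 * (real N / (2 * real d * ln (6 * exp 1)))"
        by simp
      also have "\<dots> \<le> 4 * X"
        unfolding X_def by (intro mult_left_mono) auto
      finally show "2 * real N / L \<le> 4 * X" .
    qed
    also have "sqrt (4 * X) = 2 * sqrt X"
      by (simp add: real_sqrt_mult)
    \<comment> \<open>Since \<open>sqrt X \<ge> 1\<close>, it absorbs the summand 1; the resulting 3
      times \<open>2 * exp 1\<close> is the constant \<open>6 * exp 1\<close> in
      \<open>eta\<close>.\<close>
    finally have "1 / \<delta> + 1 \<le> 3 * sqrt X"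
      using real_sqrt_ge_one[OF \<open>1 \<le> X\<close>] by linarith
    then have "2 * exp 1 * (1 / \<delta> + 1) \<le> 2 * exp 1 * (3 * sqrt X)"
      by (intro mult_left_mono) auto
    then have "2 * exp 1 * (1 / \<delta> + 1) \<le> eta N d"
      unfolding eta by simp
    then have card: "(2 * exp 1 * (1 / \<delta> + 1)) ^ d \<le> eta N d ^ d"
      using \<open>0 < \<delta>\<close> by (intro power_mono) auto
    have exponent: "- 2 * real N * \<delta>\<^sup>2 = - L"
      using \<open>0 < L\<close> \<open>0 < N\<close> by (simp add: \<delta>_def power_divide power_mult_distrib)
    \<comment> \<open>The three summands of \<open>L\<close> cancel the cover size, the dependence
      factor and the 2 of the two-sided bound, leaving exactly \<open>1 - \<theta>\<close>.\<close>
    have "exp L = eta N d ^ d * exp (\<rho> * real d) * (2 / (1 - \<theta>))"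
      unfolding L_def exp_add exp_of_nat_mult using \<open>0 < eta N d\<close> \<theta> by simp
    then have exp_L: "exp (- L) = (1 - \<theta>) / (2 * exp (\<rho> * real d) * eta N d ^ d)"
      by (simp add: exp_minus field_simps)
    have "2 * exp (\<rho> * real d) * (2 * exp 1 * (1 / \<delta> + 1)) ^ d * exp (- 2 * real N * \<delta>\<^sup>2)
        \<le> 2 * exp (\<rho> * real d) * eta N d ^ d * exp (- L)"
      unfolding exponent using card by (intro mult_right_mono mult_left_mono) auto
    also have "\<dots> = 1 - \<theta>"
      unfolding exp_L using \<open>0 < eta N d\<close> by simp
    finally have "\<theta> \<le> prob {\<omega>\<in>space M. star_discrepancy N (\<lambda>j. p j \<omega>) \<le> 2 * \<delta>}"
      using tail[OF \<open>0 < \<delta>\<close>] by linarith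
    then show ?thesis
      by (simp add: \<delta>_def L_def)
  qed
  ultimately show ?thesis by blast
qed

end
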